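(* Let $k\ge1$ be an integer. Every polynomial in $(\xi,\eta,\zeta)$ of total degree at most $k$, restricted to $\Omega$, belongs to $\mathcal U^{(0),k}(\Omega)$; that is, $P^{k}\subset\mathcal U^{(0),k}(\Omega)$.
   Context: $\Omega=\{(\xi,\eta,\zeta)\in\mathbb R^3:\xi,\eta,\zeta\ge0,\ \xi\le1-\zeta,\ \eta\le1-\zeta\}$; $\Omega_\infty=\{(x,y,z):0\le x,y\le1,\ z\ge0\}$ together with a point $\infty$; $\phi:\Omega_\infty\to\Omega$, $\phi(x,y,z)=\left(\frac{x}{1+z},\frac{y}{1+z},\frac{z}{1+z}\right)$, $\phi(\infty)=(0,0,1)$. $Q^{l,m,n}_k$ is the space of functions $u/(1+z)^k$ with $u$ a polynomial of degree at most $l,m,n$ in $x,y,z$; $P^n_k[w,z]=\{u(w,z)/(1+z)^k:u$ polynomial of total degree $\le n\}$. $\mathcal U^{(0),k}(\Omega_\infty)$ is the set of all $u\in Q_k^{k,k,k-1}\oplus\mathrm{span}\{z^k/(1+z)^k\}$ whose restrictions to the faces $y=0,1$ lie in $P_k^k[x,z]$ and to the faces $x=0,1$ lie in $P_k^k[y,z]$. $\mathcal U^{(0),k}(\Omega)=\{u\circ\phi^{-1}:u\in\mathcal U^{(0),k}(\Omega_\infty)\}$ (extended continuously to the apex). *)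

theory Defs
  imports "HOL-Analysis.Analysis"
begin

type_synonym point = "real \<times> real \<times> real"

definition Omega :: "point set" where
  "Omega = {(\<xi>, \<eta>, \<zeta>). 0 \<le> \<xi> \<and> 0 \<le> \<eta> \<and> 0 \<le> \<zeta> \<and> \<xi> \<le> 1 - \<zeta> \<and> \<eta> \<le> 1 - \<zeta>}"

definition Omega_fin :: "point set" where
  "Omega_fin = {(x, y, z). 0 \<le> x \<and> x \<le> 1 \<and> 0 \<le> y \<and> y \<le> 1 \<and> 0 \<le> z}"

text \<open>The infinite pyramid; \<open>None\<close> is the point at infinity.\<close>

definition Omega_inf :: "point option set" where
  "Omega_inf = insert None (Some ` Omega_fin)"

fun phi :: "point option \<Rightarrow> point" where
  "phi (Some (x, y, z)) = (x / (1 + z), y / (1 + z), z / (1 + z))"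
| "phi None = (0, 0, 1)"

text \<open>Real polynomial functions, given by their coefficients: in three variables with
  bounded degree in each variable, and in three or two variables with bounded total degree.\<close>

definition poly_deg :: "nat \<Rightarrow> nat \<Rightarrow> nat \<Rightarrow> (point \<Rightarrow> real) set" where
  "poly_deg l m n =
     {p. \<exists>a :: nat \<Rightarrow> nat \<Rightarrow> nat \<Rightarrow> real.
           p = (\<lambda>(x, y, z). \<Sum>i\<le>l. \<Sum>j\<le>m. \<Sum>h\<le>n. a i j h * x ^ i * y ^ j * z ^ h)}"

definition poly3 :: "nat \<Rightarrow> (point \<Rightarrow> real) set" where
  "poly3 n =
     {p. \<exists>a :: nat \<Rightarrow> nat \<Rightarrow> nat \<Rightarrow> real.
           p = (\<lambda>(x, y, z). \<Sum>(i, j, h) | i + j + h \<le> n. a i j h * x ^ i * y ^ j * z ^ h)}"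

definition poly2 :: "nat \<Rightarrow> (real \<times> real \<Rightarrow> real) set" where
  "poly2 n =
     {p. \<exists>a :: nat \<Rightarrow> nat \<Rightarrow> real.
           p = (\<lambda>(w, z). \<Sum>(i, j) | i + j \<le> n. a i j * w ^ i * z ^ j)}"

definition Q :: "nat \<Rightarrow> nat \<Rightarrow> nat \<Rightarrow> nat \<Rightarrow> (point \<Rightarrow> real) set" where
  "Q k l m n = {f. \<exists>u \<in> poly_deg l m n. f = (\<lambda>(x, y, z). u (x, y, z) / (1 + z) ^ k)}"

definition P :: "nat \<Rightarrow> nat \<Rightarrow> (real \<times> real \<Rightarrow> real) set" where
  "P k n = {f. \<exists>u \<in> poly2 n. f = (\<lambda>(w, z). u (w, z) / (1 + z) ^ k)}"

text \<open>The rational functions above have no formula at infinity, so the elements of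
  \<open>U0_inf k\<close> are functions on the finite points of \<open>Omega_inf\<close>; a value at infinity
  enters only through the continuous extension to the apex in \<open>U0 k\<close>.
  A function on a set is represented by its extensional extension.\<close>

definition U0_inf :: "nat \<Rightarrow> (point \<Rightarrow> real) set" where
  "U0_inf k =
     {u \<in> extensional Omega_fin.
        (\<exists>q \<in> Q k k k (k - 1). \<exists>c :: real. \<forall>(x, y, z) \<in> Omega_fin.
            u (x, y, z) = q (x, y, z) + c * (z ^ k / (1 + z) ^ k)) \<and>
        (\<forall>b \<in> {0, 1}. \<exists>p \<in> P k k. \<forall>x \<in> {0..1}. \<forall>z \<ge> 0. u (x, b, z) = p (x, z)) \<and>
        (\<forall>b \<in> {0, 1}. \<exists>p \<in> P k k. \<forall>y \<in> {0..1}. \<forall>z \<ge> 0. u (b, y, z) = p (y, z))}"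

definition U0 :: "nat \<Rightarrow> (point \<Rightarrow> real) set" where
  "U0 k =
     {f \<in> extensional Omega.
        (\<exists>u \<in> U0_inf k. \<forall>w \<in> Omega - {phi None}.
            f w = u (the (inv_into Omega_inf phi w))) \<and>
        continuous (at (phi None) within Omega) f}"

text \<open>Hence \<open>inv_into Omega_inf phi\<close>, used in \<open>U0\<close>, is the two-sided inverse of \<open>phi\<close>.\<close>

lemma bij_betw_phi: "bij_betw phi Omega_inf Omega"
proof (rule bij_betw_byWitness[where
      f' = "\<lambda>(x, y, z). if z = 1 then None else Some (x / (1 - z), y / (1 - z), z / (1 - z))"])
  let ?g = "\<lambda>(x, y, z). if z = 1 then None else Some (x / (1 - z), y / (1 - z), z / (1 - z :: real))"
  have fin: "?g (phi (Some (x, y, z))) = Some (x, y, z)" if "0 \<le> z" for x y z :: real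
  proof -
    have "1 - z / (1 + z) = 1 / (1 + z)" "z / (1 + z) \<noteq> 1"
      using that by (simp_all add: field_simps)
    then show ?thesis using that by simp
  qed
  show "\<forall>p \<in> Omega_inf. ?g (phi p) = p"
  proof
    fix p assume p: "p \<in> Omega_inf"
    show "?g (phi p) = p"
    proof (cases p)
      case None
      then show ?thesis by simp
    next
      case (Some v)
      obtain x y z where v: "v = (x, y, z)" by (cases v)
      have "0 \<le> z" using p Some v by (auto simp: Omega_inf_def Omega_fin_def)
      then show ?thesis unfolding Some v by (rule fin)
    qed
  qed
  have inv: "phi (?g (x, y, z)) = (x, y, z)" if "(x, y, z) \<in> Omega" for x y z :: real
  proof (cases "z = 1")
    case True
    then show ?thesis using that by (simp add: Omega_def)
  next
    case False
    then have "1 + z / (1 - z) = 1 / (1 - z)" by (simp add: field_simps)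
    then show ?thesis using False by simp
  qed
  show "\<forall>w \<in> Omega. phi (?g w) = w"
  proof
    fix w assume w: "w \<in> Omega"
    obtain x y z where v: "w = (x, y, z)" by (cases w)
    show "phi (?g w) = w" unfolding v by (rule inv) (use w v in simp)
  qed
  show "phi ` Omega_inf \<subseteq> Omega"
  proof -
    have "phi (Some (x, y, z)) \<in> Omega" if "(x, y, z) \<in> Omega_fin" for x y z
    proof -
      have "1 - z / (1 + z) = 1 / (1 + z)"
        using that by (simp add: Omega_fin_def field_simps)
      then show ?thesis using that by (simp add: Omega_fin_def Omega_def divide_right_mono)
    qed
    moreover have "phi None \<in> Omega" by (simp add: Omega_def)
    ultimately show ?thesis
      by (auto simp: Omega_inf_def simp del: phi.simps)
  qed
  have ginf: "?g (x, y, z) \<in> Omega_inf" if "(x, y, z) \<in> Omega" for x y z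
  proof (cases "z = 1")
    case True
    then show ?thesis by (simp add: Omega_inf_def)
  next
    case False
    then have "(x / (1 - z), y / (1 - z), z / (1 - z)) \<in> Omega_fin"
      using that by (simp add: Omega_fin_def Omega_def)
    then show ?thesis using False by (simp add: Omega_inf_def)
  qed
  show "?g ` Omega \<subseteq> Omega_inf"
  proof (rule image_subsetI)
    fix w assume w: "w \<in> Omega"
    obtain x y z where v: "w = (x, y, z)" by (cases w)
    show "?g w \<in> Omega_inf" unfolding v by (rule ginf) (use w v in simp)
  qed
qed

end

theory Submission
  imports Defs
begin

text \<open>Composing a polynomial of total degree at most \<open>k\<close> with \<open>phi\<close> and clearing the
  denominator \<open>(1 + z) ^ k\<close> turns each monomial \<open>\<xi> ^ i * \<eta> ^ j * \<zeta> ^ h\<close> into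
  \<open>x ^ i * y ^ j * z ^ h * (1 + z) ^ (k - i - j - h)\<close>, again of total degree at most \<open>k\<close>.
  Only the monomial \<open>z ^ k\<close> of such a numerator can have degree \<open>k\<close> in \<open>z\<close>, and fixing \<open>x\<close> or
  \<open>y\<close> leaves total degree at most \<open>k\<close> in the remaining two variables.\<close>

section \<open>Monomials and sums in the total-degree spaces\<close>

lemma finite_triples: "finite {(i, j, h). i + j + h \<le> (n :: nat)}"
  by (rule finite_subset[of _ "{..n} \<times> {..n} \<times> {..n}"]) auto

lemma finite_pairs: "finite {(i, j). i + j \<le> (n :: nat)}"
  by (rule finite_subset[of _ "{..n} \<times> {..n}"]) auto

text \<open>The coefficient array is \<open>c\<close> at one index triple and 0 elsewhere. Together
  with \<open>poly3_sum\<close>, this allows membership to be checked term by term, without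
  collecting coefficients.\<close>

lemma poly3_monomial:
  assumes "i + j + h \<le> n"
  shows "(\<lambda>(x, y, z). c * x ^ i * y ^ j * z ^ h) \<in> poly3 n"
proof -
  let ?a = "\<lambda>i' j' h'. if (i', j', h') = (i, j, h) then c else 0"
  have "c * x ^ i * y ^ j * z ^ h =
      (\<Sum>(i', j', h') | i' + j' + h' \<le> n. ?a i' j' h' * x ^ i' * y ^ j' * z ^ h')"
    for x y z :: real
  proof -
    have "(\<Sum>(i', j', h') | i' + j' + h' \<le> n. ?a i' j' h' * x ^ i' * y ^ j' * z ^ h') =
        (\<Sum>s | s \<in> {(i', j', h'). i' + j' + h' \<le> n}.
          if s = (i, j, h) then c * x ^ i * y ^ j * z ^ h else 0)"
      by (rule sum.cong) (auto split: if_splits)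
    also have "\<dots> = c * x ^ i * y ^ j * z ^ h"
      using assms finite_triples[of n] by (simp add: sum.delta)
    finally show ?thesis by simp
  qed
  then show ?thesis
    unfolding poly3_def by (intro CollectI exI[of _ ?a]) (simp only:)
qed

lemma poly2_monomial:
  assumes "i + j \<le> n"
  shows "(\<lambda>(w, z). c * w ^ i * z ^ j) \<in> poly2 n"
proof -
  let ?a = "\<lambda>i' j'. if (i', j') = (i, j) then c else 0"
  have "c * w ^ i * z ^ j = (\<Sum>(i', j') | i' + j' \<le> n. ?a i' j' * w ^ i' * z ^ j')"
    for w z :: real
  proof -
    have "(\<Sum>(i', j') | i' + j' \<le> n. ?a i' j' * w ^ i' * z ^ j') =
        (\<Sum>s | s \<in> {(i', j'). i' + j' \<le> n}. if s = (i, j) then c * w ^ i * z ^ j else 0)"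
      by (rule sum.cong) (auto split: if_splits)
    also have "\<dots> = c * w ^ i * z ^ j"
      using assms finite_pairs[of n] by (simp add: sum.delta)
    finally show ?thesis by simp
  qed
  then show ?thesis
    unfolding poly2_def by (intro CollectI exI[of _ ?a]) (simp only:)
qed

text \<open>Coefficient arrays chosen for all summands at once add up, after the two sums are
  exchanged. For infinite \<open>S\<close> all sums over \<open>S\<close> are 0 by convention,
  consistently on both sides.\<close>

lemma poly3_sum:
  assumes "\<And>s. s \<in> S \<Longrightarrow> f s \<in> poly3 n"
  shows "(\<lambda>v. \<Sum>s\<in>S. f s v) \<in> poly3 n"
proof -
  have "\<forall>s\<in>S. \<exists>a. f s =
      (\<lambda>(x, y, z). \<Sum>(i, j, h) | i + j + h \<le> n. a i j h * x ^ i * y ^ j * z ^ h)"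
    using assms unfolding poly3_def by blast
  from bchoice[OF this] obtain A where A: "\<forall>s\<in>S. f s =
      (\<lambda>(x, y, z). \<Sum>(i, j, h) | i + j + h \<le> n. A s i j h * x ^ i * y ^ j * z ^ h)"
    by blast
  have "(\<Sum>s\<in>S. f s (x, y, z)) =
      (\<Sum>(i, j, h) | i + j + h \<le> n. (\<Sum>s\<in>S. A s i j h) * x ^ i * y ^ j * z ^ h)" for x y z
  proof -
    have "(\<Sum>s\<in>S. f s (x, y, z)) =
        (\<Sum>s\<in>S. \<Sum>(i, j, h) | i + j + h \<le> n. A s i j h * x ^ i * y ^ j * z ^ h)"
      by (intro sum.cong refl) (simp add: A)
    also have "\<dots> = (\<Sum>(i, j, h) | i + j + h \<le> n. (\<Sum>s\<in>S. A s i j h) * x ^ i * y ^ j * z ^ h)"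
      by (subst sum.swap) (simp add: split_def sum_distrib_right)
    finally show ?thesis .
  qed
  then show ?thesis
    unfolding poly3_def by (intro CollectI exI[of _ "\<lambda>i j h. \<Sum>s\<in>S. A s i j h"]) auto
qed

lemma poly2_sum:
  assumes "\<And>s. s \<in> S \<Longrightarrow> f s \<in> poly2 n"
  shows "(\<lambda>v. \<Sum>s\<in>S. f s v) \<in> poly2 n"
proof -
  have "\<forall>s\<in>S. \<exists>a. f s = (\<lambda>(w, z). \<Sum>(i, j) | i + j \<le> n. a i j * w ^ i * z ^ j)"
    using assms unfolding poly2_def by blast
  from bchoice[OF this] obtain A where A: "\<forall>s\<in>S.
      f s = (\<lambda>(w, z). \<Sum>(i, j) | i + j \<le> n. A s i j * w ^ i * z ^ j)"
    by blast
  have "(\<Sum>s\<in>S. f s (w, z)) = (\<Sum>(i, j) | i + j \<le> n. (\<Sum>s\<in>S. A s i j) * w ^ i * z ^ j)" for w z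
  proof -
    have "(\<Sum>s\<in>S. f s (w, z)) = (\<Sum>s\<in>S. \<Sum>(i, j) | i + j \<le> n. A s i j * w ^ i * z ^ j)"
      by (intro sum.cong refl) (simp add: A)
    also have "\<dots> = (\<Sum>(i, j) | i + j \<le> n. (\<Sum>s\<in>S. A s i j) * w ^ i * z ^ j)"
      by (subst sum.swap) (simp add: split_def sum_distrib_right)
    finally show ?thesis .
  qed
  then show ?thesis
    unfolding poly2_def by (intro CollectI exI[of _ "\<lambda>i j. \<Sum>s\<in>S. A s i j"]) auto
qed

section \<open>Restriction to faces and splitting off the top power\<close>

lemma poly3_face_y:
  assumes "p \<in> poly3 n"
  shows "(\<lambda>(x, z). p (x, b, z)) \<in> poly2 n"
proof -
  obtain a where a: "p = (\<lambda>(x, y, z). \<Sum>(i, j, h) | i + j + h \<le> n. a i j h * x ^ i * y ^ j * z ^ h)"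
    using assms unfolding poly3_def by blast
  \<comment> \<open>The factor \<open>b ^ j\<close> joins the coefficient, leaving exponents with
    \<open>i + h \<le> n\<close>. Different \<open>j\<close> may give the same monomial, so terms
    are summed by \<open>poly2_sum\<close> rather than regrouped.\<close>
  have "(\<lambda>v. \<Sum>s \<in> {(i, j, h). i + j + h \<le> n}.
      (case s of (i, j, h) \<Rightarrow> \<lambda>(x, z). (a i j h * b ^ j) * x ^ i * z ^ h) v) \<in> poly2 n"
    by (intro poly2_sum) (auto intro!: poly2_monomial)
  moreover have "(\<lambda>v. \<Sum>s \<in> {(i, j, h). i + j + h \<le> n}.
      (case s of (i, j, h) \<Rightarrow> \<lambda>(x, z). (a i j h * b ^ j) * x ^ i * z ^ h) v) =
      (\<lambda>(x, z). p (x, b, z))"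
    unfolding a by (auto simp: fun_eq_iff mult_ac intro!: sum.cong)
  ultimately show ?thesis by simp
qed

lemma poly3_face_x:
  assumes "p \<in> poly3 n"
  shows "(\<lambda>(y, z). p (b, y, z)) \<in> poly2 n"
proof -
  obtain a where a: "p = (\<lambda>(x, y, z). \<Sum>(i, j, h) | i + j + h \<le> n. a i j h * x ^ i * y ^ j * z ^ h)"
    using assms unfolding poly3_def by blast
  have "(\<lambda>v. \<Sum>s \<in> {(i, j, h). i + j + h \<le> n}.
      (case s of (i, j, h) \<Rightarrow> \<lambda>(y, z). (a i j h * b ^ i) * y ^ j * z ^ h) v) \<in> poly2 n"
    by (intro poly2_sum) (auto intro!: poly2_monomial)
  moreover have "(\<lambda>v. \<Sum>s \<in> {(i, j, h). i + j + h \<le> n}.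
      (case s of (i, j, h) \<Rightarrow> \<lambda>(y, z). (a i j h * b ^ i) * y ^ j * z ^ h) v) =
      (\<lambda>(y, z). p (b, y, z))"
    unfolding a by (auto simp: fun_eq_iff mult_ac intro!: sum.cong)
  ultimately show ?thesis by simp
qed

text \<open>If \<open>i + j + h \<le> k\<close> and \<open>h = k\<close>, then
  \<open>i = j = 0\<close>; every other term has degree at most \<open>k - 1\<close> in
  \<open>z\<close>.\<close>

lemma poly3_split_top:
  assumes "p \<in> poly3 k" and "k \<ge> 1"
  obtains q c where "q \<in> poly_deg k k (k - 1)"
    and "\<And>x y z. p (x, y, z) = q (x, y, z) + c * z ^ k"
proof -
  obtain a where a: "p = (\<lambda>(x, y, z). \<Sum>(i, j, h) | i + j + h \<le> k. a i j h * x ^ i * y ^ j * z ^ h)"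
    using assms(1) unfolding poly3_def by blast
  \<comment> \<open>Zero padding: \<open>poly_deg\<close> sums over a full box, while
    \<open>a\<close> is arbitrary outside the simplex.\<close>
  let ?b = "\<lambda>i j h. if i + j + h \<le> k then a i j h else 0"
  let ?q = "\<lambda>(x, y, z). \<Sum>i\<le>k. \<Sum>j\<le>k. \<Sum>h\<le>k - 1. ?b i j h * x ^ i * y ^ j * z ^ h"
  let ?T = "{(i, j, h). i + j + h \<le> k}"
  have "?q \<in> poly_deg k k (k - 1)"
    unfolding poly_deg_def by (intro CollectI exI[of _ ?b]) (rule refl)
  moreover have "p (x, y, z) = ?q (x, y, z) + a 0 0 k * z ^ k" for x y z
  proof -
    let ?t = "\<lambda>(i, j, h). a i j h * x ^ i * y ^ j * z ^ h"
    have "?q (x, y, z) =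
        (\<Sum>(i, j, h) \<in> {..k} \<times> {..k} \<times> {..k - 1}. ?b i j h * x ^ i * y ^ j * z ^ h)"
      by (simp add: sum.cartesian_product)
    \<comment> \<open>Dropping the padded zeros leaves the box intersected with the simplex. Since
      \<open>k \<ge> 1\<close>, truncated subtraction is harmless and exactly
      \<open>(0, 0, k)\<close> is missing.\<close>
    also have "\<dots> = sum ?t (?T - {(0, 0, k)})"
      using assms(2) by (intro sum.mono_neutral_cong_right) (auto split: if_splits)
    finally have "?q (x, y, z) = sum ?t (?T - {(0, 0, k)})" .
    moreover have "p (x, y, z) = sum ?t ?T"
      unfolding a by simp
    moreover have "sum ?t ?T = ?t (0, 0, k) + sum ?t (?T - {(0, 0, k)})"
      by (rule sum.remove[OF finite_triples]) simp
    ultimately show ?thesis by simp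
  qed
  ultimately show thesis by (rule that)
qed

section \<open>Pullback along \<open>phi\<close>\<close>

lemma poly3_phi:
  assumes "p \<in> poly3 k"
  obtains N where "N \<in> poly3 k"
    and "\<And>x y z. 0 \<le> z \<Longrightarrow> p (phi (Some (x, y, z))) = N (x, y, z) / (1 + z) ^ k"
proof -
  obtain a where a: "p = (\<lambda>(x, y, z). \<Sum>(i, j, h) | i + j + h \<le> k. a i j h * x ^ i * y ^ j * z ^ h)"
    using assms unfolding poly3_def by blast
  let ?T = "{(i, j, h). i + j + h \<le> k}"
  \<comment> \<open>The inner sum is the binomial expansion of
    \<open>z ^ h * (1 + z) ^ (k - i - j - h)\<close> with its coefficient and \<open>x\<close>,
    \<open>y\<close> powers; each term has total degree
    \<open>i + j + h + r \<le> k\<close>.\<close>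
  let ?N = "\<lambda>v. \<Sum>s \<in> ?T. (case s of (i, j, h) \<Rightarrow> \<lambda>v. \<Sum>r\<le>k - i - j - h.
      (case v of (x, y, z) \<Rightarrow>
        (a i j h * real ((k - i - j - h) choose r)) * x ^ i * y ^ j * z ^ (h + r))) v"
  have "?N \<in> poly3 k"
    by (rule poly3_sum) (clarsimp, rule poly3_sum, rule poly3_monomial, auto)
  moreover have "p (phi (Some (x, y, z))) = ?N (x, y, z) / (1 + z) ^ k" if z: "0 \<le> z" for x y z
  proof -
    have nz: "1 + z \<noteq> 0" using z by simp
    have summand: "a i j h * (x / (1 + z)) ^ i * (y / (1 + z)) ^ j * (z / (1 + z)) ^ h =
        (\<Sum>r\<le>k - i - j - h.
          a i j h * real ((k - i - j - h) choose r) * x ^ i * y ^ j * z ^ (h + r)) / (1 + z) ^ k"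
      if le: "i + j + h \<le> k" for i j h
    proof -
      let ?m = "k - i - j - h"
      \<comment> \<open>The order \<open>z + 1\<close> makes \<open>binomial_ring\<close> put the
        running exponent \<open>r\<close> on \<open>z\<close>.\<close>
      have "(\<Sum>r\<le>?m. a i j h * real (?m choose r) * x ^ i * y ^ j * z ^ (h + r)) =
          a i j h * x ^ i * y ^ j * z ^ h * (z + 1) ^ ?m"
        by (simp add: binomial_ring sum_distrib_left power_add mult_ac)
      \<comment> \<open>The first three factors are the denominators of the substituted monomial;
        the last cancels against the expanded power.\<close>
      moreover have "(1 + z) ^ k = (1 + z) ^ i * (1 + z) ^ j * (1 + z) ^ h * (1 + z) ^ ?m"
        using le by (simp flip: power_add)
      ultimately show ?thesis
        using nz by (simp add: power_divide add.commute)
    qed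
    show ?thesis
      unfolding a sum_divide_distrib
      by (auto simp: summand intro!: sum.cong)
  qed
  ultimately show thesis by (rule that)
qed

section \<open>Membership in the spaces on both pyramids\<close>

lemma continuous_on_poly3:
  assumes "p \<in> poly3 n"
  shows "continuous_on S p"
proof -
  obtain a where a: "p = (\<lambda>(x, y, z). \<Sum>(i, j, h) | i + j + h \<le> n. a i j h * x ^ i * y ^ j * z ^ h)"
    using assms unfolding poly3_def by blast
  show ?thesis
    unfolding a split_def by (intro continuous_intros)
qed

text \<open>A single numerator \<open>N\<close> meets all the conditions: splitting off
  \<open>z ^ k\<close> gives the interior form, and setting \<open>x\<close> or \<open>y\<close> to
  \<open>b\<close> gives the face forms.\<close>

lemma poly3_phi_in_U0_inf:
  assumes "p \<in> poly3 k" and "k \<ge> 1"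
  shows "restrict (\<lambda>v. p (phi (Some v))) Omega_fin \<in> U0_inf k"
proof -
  obtain N where N: "N \<in> poly3 k"
    and pN: "\<And>x y z. 0 \<le> z \<Longrightarrow> p (phi (Some (x, y, z))) = N (x, y, z) / (1 + z) ^ k"
    using poly3_phi[OF assms(1)] by blast
  let ?u = "restrict (\<lambda>v. p (phi (Some v))) Omega_fin"
  have u: "?u (x, y, z) = N (x, y, z) / (1 + z) ^ k" if "(x, y, z) \<in> Omega_fin" for x y z
    using that pN by (simp add: Omega_fin_def del: phi.simps)
  obtain q c where q: "q \<in> poly_deg k k (k - 1)"
    and Nq: "\<And>x y z. N (x, y, z) = q (x, y, z) + c * z ^ k"
    using poly3_split_top[OF N assms(2)] by blast
  have "\<exists>q \<in> Q k k k (k - 1). \<exists>c. \<forall>(x, y, z) \<in> Omega_fin.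
      ?u (x, y, z) = q (x, y, z) + c * (z ^ k / (1 + z) ^ k)"
  proof (intro bexI exI)
    show "(\<lambda>(x, y, z). q (x, y, z) / (1 + z) ^ k) \<in> Q k k k (k - 1)"
      unfolding Q_def using q by blast
    show "\<forall>(x, y, z) \<in> Omega_fin. ?u (x, y, z) =
        (\<lambda>(x, y, z). q (x, y, z) / (1 + z) ^ k) (x, y, z) + c * (z ^ k / (1 + z) ^ k)"
      using u by (auto simp: Nq add_divide_distrib simp del: restrict_apply phi.simps)
  qed
  moreover have "\<exists>r \<in> P k k. \<forall>x \<in> {0..1}. \<forall>z \<ge> 0. ?u (x, b, z) = r (x, z)"
    if "b \<in> {0, 1}" for b
  proof
    \<comment> \<open>The unreduced inner abstraction displays the numerator in the shape
      \<open>u (w, z)\<close> required by \<open>P\<close>.\<close>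
    show "(\<lambda>(x, z). (\<lambda>(x, z). N (x, b, z)) (x, z) / (1 + z) ^ k) \<in> P k k"
      unfolding P_def using poly3_face_y[OF N] by blast
    show "\<forall>x \<in> {0..1}. \<forall>z \<ge> 0.
        ?u (x, b, z) = (\<lambda>(x, z). (\<lambda>(x, z). N (x, b, z)) (x, z) / (1 + z) ^ k) (x, z)"
      using that by (auto simp: pN Omega_fin_def simp del: phi.simps)
  qed
  moreover have "\<exists>r \<in> P k k. \<forall>y \<in> {0..1}. \<forall>z \<ge> 0. ?u (b, y, z) = r (y, z)"
    if "b \<in> {0, 1}" for b
  proof
    show "(\<lambda>(y, z). (\<lambda>(y, z). N (b, y, z)) (y, z) / (1 + z) ^ k) \<in> P k k"
      unfolding P_def using poly3_face_x[OF N] by blast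
    show "\<forall>y \<in> {0..1}. \<forall>z \<ge> 0.
        ?u (b, y, z) = (\<lambda>(y, z). (\<lambda>(y, z). N (b, y, z)) (y, z) / (1 + z) ^ k) (y, z)"
      using that by (auto simp: pN Omega_fin_def simp del: phi.simps)
  qed
  ultimately show ?thesis
    unfolding U0_inf_def by blast
qed

theorem lemma8p4:
  fixes k :: nat
  assumes "k \<ge> 1"
  shows "(\<lambda>p. restrict p Omega) ` poly3 k \<subseteq> U0 k"
proof (rule image_subsetI)
  fix p assume p: "p \<in> poly3 k"
  \<comment> \<open>The pullback of \<open>p\<close>: composing it with the inverse of
    \<open>phi\<close> returns \<open>p\<close> away from the apex.\<close>
  let ?u = "restrict (\<lambda>v. p (phi (Some v))) Omega_fin"
  have "restrict p Omega w = ?u (the (inv_into Omega_inf phi w))"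
    if w: "w \<in> Omega - {phi None}" for w
  proof -
    have img: "w \<in> phi ` Omega_inf"
      using w bij_betw_phi by (simp add: bij_betw_def)
    have inv: "phi (inv_into Omega_inf phi w) = w" "inv_into Omega_inf phi w \<in> Omega_inf"
      using f_inv_into_f[OF img] inv_into_into[OF img] by auto
    \<comment> \<open>As \<open>w\<close> is not the apex, its preimage cannot be
      \<open>None\<close>.\<close>
    then obtain v where "inv_into Omega_inf phi w = Some v" "v \<in> Omega_fin"
      using w unfolding Omega_inf_def by auto
    then show ?thesis
      using inv w by simp
  qed
  moreover have "continuous (at (phi None) within Omega) (restrict p Omega)"
  proof -
    \<comment> \<open>On \<open>Omega\<close> the restriction agrees with the polynomial
      \<open>p\<close>, so its apex value \<open>p (0, 0, 1)\<close> is already the continuous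
      extension.\<close>
    have "continuous_on Omega (restrict p Omega)"
      using continuous_on_poly3[OF p] by (simp cong: continuous_on_cong)
    moreover have "phi None \<in> Omega"
      by (simp add: Omega_def)
    ultimately show ?thesis
      unfolding continuous_on_eq_continuous_within by blast
  qed
  ultimately show "restrict p Omega \<in> U0 k"
    unfolding U0_def using poly3_phi_in_U0_inf[OF p assms] by blast
qed

end
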